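(* For every integer $n \geq 1$, the enhanced power graph $\mathcal{P}_e(U_{6n})$ is perfect.
   Context: For $n \geq 1$, $U_{6n} = \langle a, b : a^{2n} = b^3 = e,\ ba = ab^{-1} \rangle$, a group of order $6n$. The enhanced power graph $\mathcal{P}_e(G)$ of a group $G$ is the simple undirected graph with vertex set $G$ in which two distinct vertices are adjacent if and only if they belong to a common cyclic subgroup of $G$. A graph $\Gamma$ is perfect if for every induced subgraph $\Gamma'$ of $\Gamma$ the clique number $\omega(\Gamma')$ equals the chromatic number $\chi(\Gamma')$. *)

theory Defs
  imports
    "HOL-Algebra.Elementary_Groups"
    "HOL-Library.Extended_Nat"
    "Graph_Theory.Graph_Theory"
begin

section \<open>Groups given by generators and relations\<close>

text \<open>
  The letter \<open>(x, True)\<close> stands for the generator \<open>x\<close> and \<open>(x, False)\<close> for its formal inverse.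
  Words multiply by concatenation. The defining relations are given as a set of pairs of words
  \<open>(u, v)\<close>, each standing for the equation \<open>u = v\<close>.
\<close>

type_synonym 'g word = "('g \<times> bool) list"

inductive pres_eq :: "('g word \<times> 'g word) set \<Rightarrow> 'g word \<Rightarrow> 'g word \<Rightarrow> bool"
  for R :: "('g word \<times> 'g word) set" where
  relation: "(u, v) \<in> R \<Longrightarrow> pres_eq R u v"
| cancel: "pres_eq R [(x, s), (x, \<not> s)] []"
| refl: "pres_eq R u u"
| sym: "pres_eq R u v \<Longrightarrow> pres_eq R v u"
| trans: "pres_eq R u v \<Longrightarrow> pres_eq R v w \<Longrightarrow> pres_eq R u w"
| append: "pres_eq R u u' \<Longrightarrow> pres_eq R v v' \<Longrightarrow> pres_eq R (u @ v) (u' @ v')"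

definition pres_rel :: "('g word \<times> 'g word) set \<Rightarrow> ('g word \<times> 'g word) set" where
  "pres_rel R = {(u, v). pres_eq R u v}"

text \<open>
  The group with all elements of the type \<open>'g\<close> as generators and with defining relations \<open>R\<close>.
  Its elements are the classes of words modulo the congruence generated by \<open>R\<close> and by the
  cancellation of a letter with its inverse.
\<close>

definition presented_group :: "('g word \<times> 'g word) set \<Rightarrow> 'g word set monoid" where
  "presented_group R =
    \<lparr> carrier = UNIV // pres_rel R,
      monoid.mult = (\<lambda>X Y. \<Union>u\<in>X. \<Union>v\<in>Y. pres_rel R `` {u @ v}),
      one = pres_rel R `` {[]} \<rparr>"

lemma equiv_pres_rel: "equiv UNIV (pres_rel R)"
  by (intro equivI refl_onI symI transI)
    (auto simp: pres_rel_def intro: pres_eq.refl pres_eq.sym pres_eq.trans)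

lemma pres_class_eq_iff:
  "pres_rel R `` {u} = pres_rel R `` {v} \<longleftrightarrow> pres_eq R u v"
  using eq_equiv_class_iff[OF equiv_pres_rel] by (simp add: pres_rel_def)

lemma presented_group_mult:
  "pres_rel R `` {u} \<otimes>\<^bsub>presented_group R\<^esub> pres_rel R `` {v} = pres_rel R `` {u @ v}"
proof -
  have "pres_rel R `` {u' @ v'} = pres_rel R `` {u @ v}"
    if "u' \<in> pres_rel R `` {u}" "v' \<in> pres_rel R `` {v}" for u' v'
    using that unfolding pres_class_eq_iff
    by (auto simp: pres_rel_def intro: pres_eq.append pres_eq.sym)
  moreover have "u \<in> pres_rel R `` {u}" "v \<in> pres_rel R `` {v}"
    by (auto simp: pres_rel_def pres_eq.refl)
  ultimately show ?thesis
    unfolding presented_group_def monoid.simps by blast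
qed

lemma pres_eq_left_inverse:
  "pres_eq R (rev (map (\<lambda>(x, s). (x, \<not> s)) u) @ u) []"
proof (induction u)
  case Nil
  show ?case by (simp add: pres_eq.refl)
next
  case (Cons a u)
  obtain x s where a: "a = (x, s)" by (cases a)
  let ?w = "rev (map (\<lambda>(x, s). (x, \<not> s)) u)"
  have "pres_eq R [(x, \<not> s), (x, s)] []"
    using pres_eq.cancel[of R x "\<not> s"] by simp
  then have "pres_eq R (?w @ ([(x, \<not> s), (x, s)] @ u)) (?w @ ([] @ u))"
    by (intro pres_eq.append pres_eq.refl)
  with Cons.IH show ?case
    by (auto simp: a intro: pres_eq.trans)
qed

lemma group_presented_group: "group (presented_group R)"
proof (rule groupI)
  let ?G = "presented_group R"
  have carr: "carrier ?G = range (\<lambda>u. pres_rel R `` {u})"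
    by (auto simp: presented_group_def quotient_def)
  have one: "\<one>\<^bsub>?G\<^esub> = pres_rel R `` {[]}"
    by (simp add: presented_group_def)
  show "\<one>\<^bsub>?G\<^esub> \<in> carrier ?G"
    by (simp add: carr one)
  fix X assume "X \<in> carrier ?G"
  then obtain u where X: "X = pres_rel R `` {u}" by (auto simp: carr)
  show "\<one>\<^bsub>?G\<^esub> \<otimes>\<^bsub>?G\<^esub> X = X"
    by (simp add: X one presented_group_mult)
  show "\<exists>Y\<in>carrier ?G. Y \<otimes>\<^bsub>?G\<^esub> X = \<one>\<^bsub>?G\<^esub>"
    using pres_eq_left_inverse[of R u]
    by (auto simp: X one carr presented_group_mult pres_class_eq_iff)
  fix Y assume "Y \<in> carrier ?G"
  then obtain v where Y: "Y = pres_rel R `` {v}" by (auto simp: carr)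
  show "X \<otimes>\<^bsub>?G\<^esub> Y \<in> carrier ?G"
    by (simp add: X Y carr presented_group_mult)
  fix Z assume "Z \<in> carrier ?G"
  then obtain w where Z: "Z = pres_rel R `` {w}" by (auto simp: carr)
  show "X \<otimes>\<^bsub>?G\<^esub> Y \<otimes>\<^bsub>?G\<^esub> Z = X \<otimes>\<^bsub>?G\<^esub> (Y \<otimes>\<^bsub>?G\<^esub> Z)"
    by (simp add: X Y Z presented_group_mult)
qed


section \<open>The group \<open>U\<^bsub>6n\<^esub>\<close>\<close>

datatype U6n_gen = gen_a | gen_b

definition U6n_relations :: "nat \<Rightarrow> (U6n_gen word \<times> U6n_gen word) set" where
  "U6n_relations n =
    {(replicate (2 * n) (gen_a, True), []),
     (replicate 3 (gen_b, True), []),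
     ([(gen_b, True), (gen_a, True)], [(gen_a, True), (gen_b, False)])}"

definition U6n :: "nat \<Rightarrow> U6n_gen word set monoid" where
  "U6n n = presented_group (U6n_relations n)"

lemma group_U6n: "group (U6n n)"
  unfolding U6n_def by (rule group_presented_group)


section \<open>The enhanced power graph\<close>

text \<open>As in \<open>Graph_Theory\<close>, an undirected graph is a symmetric digraph.\<close>

definition enhanced_power_graph :: "('a, 'b) monoid_scheme \<Rightarrow> 'a pair_pre_digraph" where
  "enhanced_power_graph G =
    \<lparr> pverts = carrier G,
      parcs = {(x, y). x \<noteq> y \<and>
        (\<exists>C. subgroup C G \<and> cyclic_group (G\<lparr>carrier := C\<rparr>) \<and> x \<in> C \<and> y \<in> C)} \<rparr>"

lemma pair_bidirected_digraph_enhanced_power_graph: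
  "pair_bidirected_digraph (enhanced_power_graph G)"
  by unfold_locales
    (auto simp: enhanced_power_graph_def symmetric_def sym_def dest: subgroup.mem_carrier)


section \<open>Perfect graphs\<close>

definition is_clique :: "('a, 'b) pre_digraph \<Rightarrow> 'a set \<Rightarrow> bool" where
  "is_clique G C \<longleftrightarrow>
    C \<subseteq> verts G \<and> (\<forall>u\<in>C. \<forall>v\<in>C. u \<noteq> v \<longrightarrow> u \<rightarrow>\<^bsub>G\<^esub> v)"

definition is_colouring :: "('a, 'b) pre_digraph \<Rightarrow> nat \<Rightarrow> ('a \<Rightarrow> nat) \<Rightarrow> bool" where
  "is_colouring G k c \<longleftrightarrow>
    c ` verts G \<subseteq> {..<k} \<and> (\<forall>u\<in>verts G. \<forall>v\<in>verts G. u \<rightarrow>\<^bsub>G\<^esub> v \<longrightarrow> c u \<noteq> c v)"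

text \<open>
  Both numbers take values in \<open>enat\<close>, so that they are meaningful without a finiteness
  assumption. For a finite loopfree graph the supremum and the infimum are attained.
\<close>

definition clique_number :: "('a, 'b) pre_digraph \<Rightarrow> enat" where
  "clique_number G = (SUP C \<in> {C. finite C \<and> is_clique G C}. enat (card C))"

definition chromatic_number :: "('a, 'b) pre_digraph \<Rightarrow> enat" where
  "chromatic_number G = (INF k \<in> {k. \<exists>c. is_colouring G k c}. enat k)"

text \<open>
  The library predicate \<open>induced_subgraph H G\<close> includes well-formedness of \<open>G\<close>, which holds for
  every enhanced power graph by \<open>pair_bidirected_digraph_enhanced_power_graph\<close>.
\<close>

definition perfect_graph :: "('a, 'b) pre_digraph \<Rightarrow> bool" where
  "perfect_graph G \<longleftrightarrow>
    (\<forall>H. induced_subgraph H G \<longrightarrow> clique_number H = chromatic_number H)"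

end

theory Submission
  imports Defs "HOL-Computational_Algebra.Primes"
begin

text \<open>
  If the closed neighbourhoods of any two adjacent vertices are nested, then in every induced
  subgraph a vertex with the smallest closed neighbourhood in the whole graph has a clique as its
  neighbourhood, and greedy colouring in the resulting elimination order needs only as many
  colours as the largest clique has vertices.

  In \<open>U\<^bsub>6n\<^esub>\<close> put \<open>c = a\<^sup>2\<close>, \<open>d\<^sub>j = a b\<^sup>j\<close> and let \<open>A = \<langle>c\<rangle> \<langle>b\<rangle>\<close> be the centralizer of \<open>b\<close>. Since
  \<open>d\<^sub>j\<^sup>2 = c\<close>, an element \<open>c\<^sup>k d\<^sub>j\<close> outside \<open>A\<close> has the cyclic group \<open>\<langle>d\<^sub>j\<rangle>\<close> as its closed neighbourhood.
  Inside \<open>A\<close> write \<open>n = 3\<^sup>e q\<close> with \<open>q\<close> prime to \<open>3\<close>: whether two elements lie in a common cyclic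
  subgroup depends only on their \<open>q\<close>-th powers, and the subgroups of a cyclic \<open>3\<close>-group form a
  chain, so the neighbourhoods of adjacent elements are nested.
\<close>

section \<open>Perfection from nested neighbourhoods\<close>

text \<open>Induction on \<open>S\<close>, removing a vertex whose closed neighbourhood is smallest
  and colouring it last. Keeping \<open>nb\<close> unrestricted lets nesting and symmetry pass
  unchanged to every smaller \<open>S\<close>.\<close>

lemma clique_bounded_colouring:
  fixes nb :: "'a \<Rightarrow> 'a set"
  assumes "finite V" "S \<subseteq> V"
    and fin: "\<And>v. v \<in> V \<Longrightarrow> finite (nb v)"
    and refl: "\<And>v. v \<in> V \<Longrightarrow> v \<in> nb v"
    and sym: "\<And>u v. u \<in> V \<Longrightarrow> v \<in> nb u \<Longrightarrow> u \<in> nb v"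
    and nested: "\<And>u v. u \<in> V \<Longrightarrow> v \<in> V \<Longrightarrow> v \<in> nb u \<Longrightarrow> nb u \<subseteq> nb v \<or> nb v \<subseteq> nb u"
    and bound: "\<And>C. C \<subseteq> S \<Longrightarrow> (\<And>x y. x \<in> C \<Longrightarrow> y \<in> C \<Longrightarrow> y \<in> nb x) \<Longrightarrow> card C \<le> k"
  shows "\<exists>c :: 'a \<Rightarrow> nat. c ` S \<subseteq> {..<k} \<and> (\<forall>x\<in>S. \<forall>y\<in>S. x \<noteq> y \<longrightarrow> y \<in> nb x \<longrightarrow> c x \<noteq> c y)"
proof -
  have "finite S" using assms(1,2) by (rule rev_finite_subset)
  then show ?thesis using assms(2) bound
  proof (induction S rule: finite_psubset_induct)
    case (psubset S)
    show ?case
    proof (cases "S = {}")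
      case False
      define v where "v = arg_min_on (\<lambda>v. card (nb v)) S"
      have v: "v \<in> S" and min: "\<And>u. u \<in> S \<Longrightarrow> card (nb v) \<le> card (nb u)"
        using psubset.hyps False arg_min_if_finite(1) arg_min_least unfolding v_def by metis+
      have "\<exists>c :: 'a \<Rightarrow> nat. c ` (S - {v}) \<subseteq> {..<k} \<and>
          (\<forall>x\<in>S - {v}. \<forall>y\<in>S - {v}. x \<noteq> y \<longrightarrow> y \<in> nb x \<longrightarrow> c x \<noteq> c y)"
      proof (rule psubset.IH)
        show "S - {v} \<subset> S" "S - {v} \<subseteq> V" using v psubset.prems(1) by auto
        show "card C \<le> k" if "C \<subseteq> S - {v}" "\<And>x y. x \<in> C \<Longrightarrow> y \<in> C \<Longrightarrow> y \<in> nb x" for C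
          using that psubset.prems(2) by blast
      qed
      then obtain c :: "'a \<Rightarrow> nat" where c: "c ` (S - {v}) \<subseteq> {..<k}"
        "\<forall>x\<in>S - {v}. \<forall>y\<in>S - {v}. x \<noteq> y \<longrightarrow> y \<in> nb x \<longrightarrow> c x \<noteq> c y"
        by (elim exE conjE)
      have sup: "nb v \<subseteq> nb x" if "x \<in> S" "x \<in> nb v" for x
      proof -
        have "x \<in> V" "v \<in> V" using that v psubset.prems(1) by auto
        then show ?thesis
          \<comment> \<open>If instead \<open>nb x\<close> is contained in \<open>nb v\<close>,
            minimality of \<open>card (nb v)\<close> forces equality.\<close>
          using nested[of v x] that(2) min[OF that(1)] card_seteq[OF fin, of v "nb x"] by blast
      qed
      have "card (nb v \<inter> S) \<le> k"
      proof (rule psubset.prems(2))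
        fix x y assume "x \<in> nb v \<inter> S" "y \<in> nb v \<inter> S"
        then show "y \<in> nb x" using sup by blast
      qed simp
      \<comment> \<open>Since \<open>v\<close> itself belongs to this clique, its neighbours in
        \<open>S\<close> use fewer than \<open>k\<close> colours and some colour \<open>m\<close> is
        free.\<close>
      moreover have "v \<in> nb v \<inter> S" using v refl psubset.prems(1) by auto
      ultimately have "card (nb v \<inter> S - {v}) < k"
        using psubset.hyps card_Diff1_less[of "nb v \<inter> S" v] by simp
      then have "card (c ` (nb v \<inter> S - {v})) < k"
        using card_image_le[of "nb v \<inter> S - {v}" c] psubset.hyps by simp
      then have "\<not> {..<k} \<subseteq> c ` (nb v \<inter> S - {v})"
        using psubset.hyps card_mono[of "c ` (nb v \<inter> S - {v})" "{..<k}"] by auto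
      then obtain m where m: "m < k" "m \<notin> c ` (nb v \<inter> S - {v})" by blast
      have "(c(v := m)) ` S \<subseteq> {..<k}" using c(1) m(1) by auto
      moreover have "(c(v := m)) x \<noteq> (c(v := m)) y"
        if "x \<in> S" "y \<in> S" "x \<noteq> y" "y \<in> nb x" for x y
      proof -
        have "x \<in> nb y" using that sym psubset.prems(1) by blast
        then show ?thesis using that m(2) c(2)[rule_format, of x y] by (auto simp: image_iff)
      qed
      ultimately show ?thesis by blast
    qed auto
  qed
qed

section \<open>Clique number against chromatic number\<close>

lemma card_clique_le_colouring:
  assumes "is_clique G C" "is_colouring G k c"
  shows "card C \<le> k"
proof -
  have "inj_on c C"
    using assms unfolding is_clique_def is_colouring_def inj_on_def by blast
  moreover have "c ` C \<subseteq> {..<k}"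
    using assms unfolding is_clique_def is_colouring_def by blast
  ultimately show ?thesis
    using card_inj_on_le[of c C "{..<k}"] by simp
qed

lemma clique_number_le_chromatic_number:
  "clique_number G \<le> chromatic_number G"
  unfolding clique_number_def chromatic_number_def
  by (intro SUP_least INF_greatest) (auto intro: card_clique_le_colouring)

text \<open>Greedy colouring along the neighbourhoods of \<open>G\<close> needs only as many colours
  as the largest clique of \<open>H\<close> has vertices; the opposite inequality holds in every
  graph.\<close>

lemma perfect_if_nested_neighbourhoods:
  fixes G :: "('a, 'b) pre_digraph"
  defines "nb \<equiv> \<lambda>u. insert u {v. u \<rightarrow>\<^bsub>G\<^esub> v}"
  assumes fin: "finite (verts G)"
    and loopfree: "\<And>u v. u \<rightarrow>\<^bsub>G\<^esub> v \<Longrightarrow> u \<noteq> v"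
    and sym: "\<And>u v. u \<rightarrow>\<^bsub>G\<^esub> v \<Longrightarrow> v \<rightarrow>\<^bsub>G\<^esub> u"
    and nested: "\<And>u v. u \<rightarrow>\<^bsub>G\<^esub> v \<Longrightarrow> nb u \<subseteq> nb v \<or> nb v \<subseteq> nb u"
  shows "perfect_graph G"
  unfolding perfect_graph_def
proof (intro allI impI)
  fix H :: "('a, 'b) pre_digraph"
  assume ind: "induced_subgraph H G"
  then have VH: "verts H \<subseteq> verts G" and wf: "wf_digraph G"
    by (auto simp: induced_subgraph_def subgraph_def)
  have dom: "u \<rightarrow>\<^bsub>H\<^esub> v \<longleftrightarrow> u \<in> verts H \<and> v \<in> verts H \<and> u \<rightarrow>\<^bsub>G\<^esub> v" for u v
    using ind by (auto simp: induced_subgraph_def subgraph_def compatible_def arcs_ends_conv)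
  have nbV: "nb v \<subseteq> verts G" if "v \<in> verts G" for v
    using that wf by (auto simp: nb_def dest: wf_digraph.adj_in_verts)
  define K where "K = {C. C \<subseteq> verts H \<and> is_clique H C}"
  have finH: "finite (verts H)" using VH fin by (rule finite_subset)
  then have "finite K" by (simp add: K_def)
  \<comment> \<open>The empty clique makes the maximum well defined even when \<open>H\<close> has
    no vertices.\<close>
  have "{} \<in> K" by (simp add: K_def is_clique_def)
  define k where "k = Max (card ` K)"
  have "k \<in> card ` K"
    unfolding k_def using \<open>finite K\<close> \<open>{} \<in> K\<close> by (intro Max_in) auto
  then obtain C0 where C0: "C0 \<in> K" "card C0 = k" by auto
  have bound: "card C \<le> k" if "C \<subseteq> verts H" "\<And>x y. x \<in> C \<Longrightarrow> y \<in> C \<Longrightarrow> y \<in> nb x" for C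
  proof -
    have "C \<in> K" using that unfolding K_def is_clique_def nb_def dom by blast
    then show ?thesis using \<open>finite K\<close> by (simp add: k_def)
  qed
  have "\<exists>c :: 'a \<Rightarrow> nat. c ` verts H \<subseteq> {..<k} \<and>
      (\<forall>x\<in>verts H. \<forall>y\<in>verts H. x \<noteq> y \<longrightarrow> y \<in> nb x \<longrightarrow> c x \<noteq> c y)"
  proof (rule clique_bounded_colouring[OF fin VH _ _ _ _ bound])
    show "finite (nb v)" if "v \<in> verts G" for v
      using nbV[OF that] fin finite_subset by blast
    show "u \<in> nb v" if "v \<in> nb u" for u v
      using that sym by (auto simp: nb_def)
    show "nb u \<subseteq> nb v \<or> nb v \<subseteq> nb u" if "v \<in> nb u" for u v
      using that nested[of u v] by (cases "u = v") (auto simp: nb_def)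
  qed (auto simp: nb_def)
  then obtain c :: "'a \<Rightarrow> nat" where c: "c ` verts H \<subseteq> {..<k}"
    "\<forall>x\<in>verts H. \<forall>y\<in>verts H. x \<noteq> y \<longrightarrow> y \<in> nb x \<longrightarrow> c x \<noteq> c y"
    by (elim exE conjE)
  have "is_colouring H k c"
    unfolding is_colouring_def
  proof (intro conjI ballI impI)
    show "c u \<noteq> c v" if "u \<in> verts H" "v \<in> verts H" "u \<rightarrow>\<^bsub>H\<^esub> v" for u v
      using that c(2)[rule_format, of u v] loopfree[of u v] by (simp add: dom nb_def)
  qed (rule c(1))
  then have "chromatic_number H \<le> enat k"
    unfolding chromatic_number_def by (auto intro: INF_lower)
  also have "enat k \<le> clique_number H"
    unfolding clique_number_def
    using C0 finite_subset[OF _ finH, of C0] by (intro SUP_upper2[of C0]) (simp_all add: K_def)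
  finally show "clique_number H = chromatic_number H"
    using clique_number_le_chromatic_number by (intro antisym)
qed

section \<open>Pairs of elements in a common cyclic subgroup\<close>

context group
begin

abbreviation cyc :: "'a \<Rightarrow> 'a set" where
  "cyc g \<equiv> range (\<lambda>k::int. g [^] k)"

text \<open>Adjacency in terms of a generator, with equality of the two elements allowed, so that
  \<open>Collect (cocyclic x)\<close> is the closed neighbourhood of \<open>x\<close>.\<close>

definition cocyclic :: "'a \<Rightarrow> 'a \<Rightarrow> bool" where
  "cocyclic x y \<longleftrightarrow> (\<exists>g\<in>carrier G. x \<in> cyc g \<and> y \<in> cyc g)"

lemma cyc_closed: "g \<in> carrier G \<Longrightarrow> x \<in> cyc g \<Longrightarrow> x \<in> carrier G"
  by auto

lemma cyc_self: "g \<in> carrier G \<Longrightarrow> g \<in> cyc g"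
  by (metis int_pow_1 rangeI)

lemma cyc_mult: "g \<in> carrier G \<Longrightarrow> x \<in> cyc g \<Longrightarrow> y \<in> cyc g \<Longrightarrow> x \<otimes> y \<in> cyc g"
  by (auto simp flip: int_pow_mult)

lemma cyc_pow: "g \<in> carrier G \<Longrightarrow> x \<in> cyc g \<Longrightarrow> x [^] (k::int) \<in> cyc g"
  by (auto simp: int_pow_pow)

lemma cyc_mono: "g \<in> carrier G \<Longrightarrow> x \<in> cyc g \<Longrightarrow> cyc x \<subseteq> cyc g"
  using cyc_pow by blast

lemma subgroup_cyc: "g \<in> carrier G \<Longrightarrow> subgroup (cyc g) G"
  by (rule subgroupI) (auto simp flip: int_pow_mult int_pow_neg)

lemma enhanced_power_graph_dominates_iff:
  "x \<rightarrow>\<^bsub>with_proj (enhanced_power_graph G)\<^esub> y \<longleftrightarrow> x \<noteq> y \<and> cocyclic x y"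
proof -
  have "(\<exists>C. subgroup C G \<and> cyclic_group (G\<lparr>carrier := C\<rparr>) \<and> x \<in> C \<and> y \<in> C) \<longleftrightarrow> cocyclic x y"
  proof
    assume "\<exists>C. subgroup C G \<and> cyclic_group (G\<lparr>carrier := C\<rparr>) \<and> x \<in> C \<and> y \<in> C"
    then obtain C where C: "subgroup C G" "cyclic_group (G\<lparr>carrier := C\<rparr>)" "x \<in> C" "y \<in> C"
      by blast
    interpret C: group "G\<lparr>carrier := C\<rparr>"
      using C(1) by (rule subgroup_imp_group)
    obtain g where g: "g \<in> C" "C = range (\<lambda>n::int. g [^]\<^bsub>G\<lparr>carrier := C\<rparr>\<^esub> n)"
      using C(2) unfolding C.cyclic_group by auto
    \<comment> \<open>Powers taken in the subgroup agree with powers in \<open>G\<close>, so the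
      cyclic subgroups are exactly the sets \<open>cyc g\<close>.\<close>
    then have "C = cyc g"
      using int_pow_consistent[OF C(1) g(1), symmetric] by simp
    then show "cocyclic x y"
      unfolding cocyclic_def using C(3,4) subgroup.mem_carrier[OF C(1) g(1)] by (intro bexI[of _ g]) auto
  next
    assume "cocyclic x y"
    then obtain g where g: "g \<in> carrier G" "x \<in> cyc g" "y \<in> cyc g"
      unfolding cocyclic_def by blast
    note sg = subgroup_cyc[OF g(1)]
    interpret C: group "G\<lparr>carrier := cyc g\<rparr>"
      using sg by (rule subgroup_imp_group)
    have "cyclic_group (G\<lparr>carrier := cyc g\<rparr>)"
      unfolding C.cyclic_group
      using cyc_self[OF g(1)] int_pow_consistent[OF sg cyc_self[OF g(1)], symmetric]
      by (intro bexI[of _ g]) simp_all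
    then show "\<exists>C. subgroup C G \<and> cyclic_group (G\<lparr>carrier := C\<rparr>) \<and> x \<in> C \<and> y \<in> C"
      using g sg by blast
  qed
  then show ?thesis by (simp add: enhanced_power_graph_def)
qed

lemma cocyclic_sym: "cocyclic x y \<Longrightarrow> cocyclic y x"
  by (auto simp: cocyclic_def)

lemma cocyclic_refl: "x \<in> carrier G \<Longrightarrow> cocyclic x x"
  unfolding cocyclic_def by (intro bexI[of _ x] conjI cyc_self)

section \<open>Exponent arithmetic in cyclic groups\<close>

lemma pow_mem_cyc_pow_if_gcd_dvd:
  fixes l m N :: int
  assumes h: "h \<in> carrier G" "h [^] N = \<one>" and "gcd m N dvd l"
  shows "h [^] l \<in> cyc (h [^] m)"
proof -
  obtain t where "l = gcd m N * t" using assms(3) by auto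
  \<comment> \<open>Bezout makes \<open>l\<close> a combination of \<open>m\<close> and
    \<open>N\<close>, and the multiple of \<open>N\<close> contributes only the identity.\<close>
  moreover obtain u v where "u * m + v * N = gcd m N" using bezout_int by blast
  ultimately have "l = (u * m + v * N) * t" by simp
  then have "l = m * (u * t) + N * (v * t)" by (simp add: algebra_simps)
  then have "h [^] l = (h [^] m) [^] (u * t)"
    using h by (simp add: int_pow_mult flip: int_pow_pow)
  then show ?thesis by blast
qed

text \<open>The gcds of \<open>l\<close> and \<open>m\<close> with \<open>p ^ f\<close> are powers
  of \<open>p\<close>, hence comparable; the smaller one divides both exponents.\<close>

lemma prime_power_order_chain:
  fixes p :: int and l m :: int
  assumes "prime p" and h: "h \<in> carrier G" "h [^] (p ^ f) = \<one>"
  shows "h [^] l \<in> cyc (h [^] m) \<or> h [^] m \<in> cyc (h [^] l)"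
proof -
  obtain i where i: "gcd m (p ^ f) = p ^ i"
    using divides_primepow[OF assms(1), of "gcd m (p ^ f)" f] by auto
  obtain k where k: "gcd l (p ^ f) = p ^ k"
    using divides_primepow[OF assms(1), of "gcd l (p ^ f)" f] by auto
  have "p ^ i dvd p ^ k \<or> p ^ k dvd p ^ i"
    using le_imp_power_dvd nat_le_linear by blast
  then have "gcd m (p ^ f) dvd l \<or> gcd l (p ^ f) dvd m"
    by (metis i k gcd_dvd1 dvd_trans)
  then show ?thesis using pow_mem_cyc_pow_if_gcd_dvd[OF h] by blast
qed

text \<open>The orders of \<open>w\<close> and \<open>z\<close> are coprime, so
  \<open>w \<otimes> z\<close> generates both factors. Bezout splits \<open>u\<close> into a power
  of \<open>u [^] q\<close> and a power of \<open>u [^] N\<close>, one in each factor.\<close>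

lemma mem_cyc_coprime_product:
  fixes N q :: int
  assumes w: "w \<in> carrier G" "w [^] N = \<one>" and z: "z \<in> carrier G" "z [^] q = \<one>"
    and comm: "w \<otimes> z = z \<otimes> w" and "coprime q N"
    and u: "u \<in> carrier G" "u [^] q \<in> cyc w" "u [^] N \<in> cyc z"
  shows "u \<in> cyc (w \<otimes> z)"
proof -
  obtain s t where st: "q * s + N * t = 1"
    using bezout_int[of q N] assms(6) by (auto simp: mult.commute)
  let ?g = "w \<otimes> z"
  have g: "?g \<in> carrier G" using w z by simp
  have split: "x = (x [^] q) [^] s \<otimes> (x [^] N) [^] t" if "x \<in> carrier G" for x
  proof -
    have "x = x [^] (q * s + N * t)" using st that by simp
    then show ?thesis using that by (simp add: int_pow_mult int_pow_pow)
  qed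
  have pow: "?g [^] k = w [^] k \<otimes> z [^] k" for k :: int
    using comm w(1) z(1) by (rule int_pow_mult_distrib)
  \<comment> \<open>The exponent \<open>q * s\<close> is 1 modulo \<open>N\<close> and 0 modulo
    \<open>q\<close>, so it keeps \<open>w\<close> and kills \<open>z\<close>.\<close>
  have "w = ?g [^] (q * s)"
    using split[OF w(1)] w z by (simp add: pow flip: int_pow_pow)
  then have "cyc w \<subseteq> cyc ?g" by (metis cyc_mono g rangeI)
  moreover have "z = ?g [^] (N * t)"
    using split[OF z(1)] w z by (simp add: pow flip: int_pow_pow)
  then have "cyc z \<subseteq> cyc ?g" by (metis cyc_mono g rangeI)
  ultimately have "(u [^] q) [^] s \<in> cyc ?g" "(u [^] N) [^] t \<in> cyc ?g"
    using u cyc_pow[OF g] by blast+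
  then show ?thesis using cyc_mult[OF g] split[OF u(1)] by metis
qed

lemma int_pow_eq_one_dvd:
  assumes "g \<in> carrier G" "g [^] (N::int) = \<one>" "N dvd m"
  shows "g [^] m = \<one>"
  using assms by (auto simp flip: int_pow_pow)

lemma finite_cyc_torsion:
  fixes N :: int
  assumes "g \<in> carrier G" "N > 0" "g [^] N = \<one>"
  shows "finite (cyc g)"
proof -
  have "g [^] k \<in> (\<lambda>k::int. g [^] k) ` {0..<N}" for k :: int
  proof (rule image_eqI)
    have "g [^] k = g [^] (N * (k div N) + k mod N)" by simp
    also have "\<dots> = g [^] (k mod N)"
      using assms(1,3) by (simp only: int_pow_mult flip: int_pow_pow) simp
    finally show "g [^] k = g [^] (k mod N)" .
  qed (use assms(2) in simp)
  then have "cyc g \<subseteq> (\<lambda>k::int. g [^] k) ` {0..<N}" by blast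
  then show ?thesis by (rule finite_subset) simp
qed

lemma int_pow_commute:
  assumes "x \<otimes> y = y \<otimes> x" "x \<in> carrier G" "y \<in> carrier G"
  shows "x [^] (i::int) \<otimes> y [^] (j::int) = y [^] j \<otimes> x [^] i"
proof -
  have *: "x [^] (i::int) \<otimes> y = y \<otimes> x [^] i"
    if "x \<otimes> y = y \<otimes> x" "x \<in> carrier G" "y \<in> carrier G" for x y i
  proof (cases i rule: int_cases2)
    case (nonneg n)
    then show ?thesis using that by (simp add: int_pow_int group_commutes_pow)
  next
    case (nonpos n)
    let ?p = "x [^] n"
    have p: "?p \<in> carrier G" "?p \<otimes> y = y \<otimes> ?p"
      using that by (simp_all add: group_commutes_pow)
    have "?p \<otimes> (y \<otimes> inv ?p) = ?p \<otimes> y \<otimes> inv ?p"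
      using p(1) that by (simp add: m_assoc)
    also have "\<dots> = y"
      using p(1) that unfolding p(2) by (simp add: m_assoc)
    finally have "y \<otimes> inv ?p = inv ?p \<otimes> y"
      using p(1) that by (simp add: inv_solve_left)
    then show ?thesis
      using nonpos that by (simp add: int_pow_neg_int)
  qed
  show ?thesis
    using *[of x y i] *[of y "x [^] i" j] assms by simp
qed

end

section \<open>Groups with the defining relations of \<open>U\<^bsub>6n\<^esub>\<close>\<close>

text \<open>The relations are only required to hold, so every quotient of the presented group is
  covered and the orders of \<open>a\<close> and \<open>b\<close> may be smaller than the exponents
  suggest.\<close>

locale U6n_presentation = group +
  fixes a b :: 'a and n :: nat
  assumes n: "n \<ge> 1"
    and a: "a \<in> carrier G" and b: "b \<in> carrier G"
    and generators: "carrier G = generate G {a, b}"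
    and a_order: "a [^] (2 * n) = \<one>"
    and b_order: "b [^] (3::nat) = \<one>"
    and ba: "b \<otimes> a = a \<otimes> inv b"
begin

definition c :: 'a where "c = a \<otimes> a"

text \<open>Integer indices spare reductions modulo 3: \<open>d j\<close> and
  \<open>d (j + 3)\<close> are the same element.\<close>

definition d :: "int \<Rightarrow> 'a" where "d j = a \<otimes> b [^] j"

lemma c: "c \<in> carrier G" using a by (simp add: c_def)

lemma d: "d j \<in> carrier G" using a b by (simp add: d_def)

lemma b_pow_3: "b [^] (3::int) = \<one>"
  using b_order int_pow_int[of G b 3] by simp

lemma c_pow_n: "c [^] (int n) = \<one>"
proof -
  have "c [^] n = a [^] n \<otimes> a [^] n"
    unfolding c_def using a by (simp add: pow_mult_distrib)
  then show ?thesis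
    using a a_order by (simp add: int_pow_int nat_pow_mult mult_2)
qed

text \<open>Conjugation by \<open>a\<close> inverts \<open>b\<close>. Induction gives natural
  exponents, and cancelling the power of \<open>b\<close> on both sides gives negative ones.\<close>

lemma b_pow_a: "b [^] (j::int) \<otimes> a = a \<otimes> b [^] (- j)"
proof -
  define z where "z = inv a \<otimes> b \<otimes> a"
  have "z = inv a \<otimes> (b \<otimes> a)" using a b by (simp add: z_def m_assoc)
  then have z: "z = inv b" using a b by (simp add: ba m_assoc[symmetric])
  have nat: "b [^] k \<otimes> a = a \<otimes> inv b [^] k" for k :: nat
  proof (induction k)
    case (Suc k)
    have "b [^] Suc k \<otimes> a = b [^] k \<otimes> (b \<otimes> a)" using a b by (simp add: m_assoc)
    also have "\<dots> = (b [^] k \<otimes> a) \<otimes> inv b" using a b by (simp add: ba m_assoc)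
    also have "\<dots> = a \<otimes> inv b [^] Suc k" using a b by (simp add: Suc m_assoc)
    finally show ?case .
  qed (use a in simp)
  show ?thesis
  proof (cases j rule: int_cases2)
    case (nonneg k)
    then show ?thesis
      using nat[of k] b by (simp add: int_pow_int int_pow_neg nat_pow_inv)
  next
    case (nonpos k)
    let ?p = "b [^] k"
    have p: "?p \<in> carrier G" "?p \<otimes> a = a \<otimes> inv ?p"
      using nat[of k] b by (simp_all add: nat_pow_inv)
    have "?p \<otimes> (a \<otimes> ?p) = (?p \<otimes> a) \<otimes> ?p" using p(1) a by (simp add: m_assoc)
    also have "\<dots> = a" using p(1) a unfolding p(2) by (simp add: m_assoc)
    finally have "a \<otimes> ?p = inv ?p \<otimes> a" using p(1) a by (simp add: inv_solve_left)
    then show ?thesis using nonpos b by (simp add: int_pow_neg_int int_pow_int)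
  qed
qed

text \<open>Moving \<open>b\<close> past \<open>a\<close> twice inverts it twice.\<close>

lemma bc: "b \<otimes> c = c \<otimes> b"
proof -
  have "b \<otimes> c = (b \<otimes> a) \<otimes> a" using a b by (simp add: c_def m_assoc)
  also have "\<dots> = a \<otimes> (b [^] (-1::int) \<otimes> a)" using a b by (simp add: ba m_assoc int_pow_neg)
  also have "\<dots> = c \<otimes> b" unfolding b_pow_a using a b by (simp add: c_def m_assoc)
  finally show ?thesis .
qed

lemma ac: "a \<otimes> c = c \<otimes> a"
  using a by (simp add: c_def m_assoc)

lemma bc_pow: "b [^] (i::int) \<otimes> c [^] (j::int) = c [^] j \<otimes> b [^] i"
  using bc b c by (rule int_pow_commute)

lemma ac_pow: "a \<otimes> c [^] (j::int) = c [^] j \<otimes> a"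
  using int_pow_commute[OF ac a c, of 1 j] a by simp

text \<open>The first power of \<open>b\<close> is inverted on passing the second \<open>a\<close>
  and cancels. Hence \<open>cyc c\<close> lies in every \<open>cyc (d j)\<close>.\<close>

lemma d_square: "d j [^] (2::int) = c"
proof -
  have "d j \<otimes> d j = a \<otimes> (b [^] j \<otimes> a) \<otimes> b [^] j"
    using a b by (simp add: d_def m_assoc)
  also have "\<dots> = c"
    unfolding b_pow_a using a b by (simp add: c_def m_assoc flip: int_pow_mult)
  finally show ?thesis
    using d int_pow_mult[of "d j" 1 1] by simp
qed

lemma c_pow_d: "c [^] k \<otimes> d j = d j [^] (2 * k + 1 :: int)"
  using d by (simp add: int_pow_mult d_square flip: int_pow_pow)

lemma c_pow_eq_d_pow: "c [^] k = d j [^] (2 * k :: int)"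
  using d by (simp add: d_square flip: int_pow_pow)

lemma cyc_c_subset_d: "cyc c \<subseteq> cyc (d j)"
  using c_pow_eq_d_pow by blast

lemma b_pow_d: "b [^] (j::int) \<otimes> d k = d (k - j)"
proof -
  have "b [^] j \<otimes> d k = (b [^] j \<otimes> a) \<otimes> b [^] k" using a b by (simp add: d_def m_assoc)
  also have "\<dots> = d (k - j)"
    unfolding b_pow_a using a b by (simp add: d_def m_assoc flip: int_pow_mult)
  finally show ?thesis .
qed

lemma d_b_pow: "d k \<otimes> b [^] (j::int) = d (k + j)"
  using a b by (simp add: d_def m_assoc int_pow_mult)

lemma elements:
  assumes "x \<in> carrier G"
  shows "(\<exists>k j. x = c [^] (k::int) \<otimes> b [^] (j::int)) \<or> (\<exists>k j. x = c [^] (k::int) \<otimes> d j)"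
proof -
  \<comment> \<open>The set of normal forms contains the identity, the generators and their
    inverses, and is closed under products.\<close>
  define P where "P x \<longleftrightarrow>
    (\<exists>k j. x = c [^] (k::int) \<otimes> b [^] (j::int)) \<or> (\<exists>k j. x = c [^] (k::int) \<otimes> d j)" for x
  have PE: "P (c [^] (k::int) \<otimes> b [^] (j::int))" "P (c [^] (k::int) \<otimes> d j)" for k j
    unfolding P_def by blast+
  note cl = a b c d
  have "P x" if "x \<in> generate G {a, b}" for x
    using that
  proof induction
    case one
    then show ?case using PE(1)[of 0 0] by simp
  next
    case (incl h)
    then show ?case using PE(2)[of 0 0] PE(1)[of 0 1] cl by (auto simp: d_def)
  next
    case (inv h)
    have "inv a = c [^] (-1::int) \<otimes> d 0"
      using cl by (simp add: c_def d_def int_pow_neg inv_mult_group m_assoc)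
    moreover have "inv b = c [^] (0::int) \<otimes> b [^] (-1::int)" using cl by (simp add: int_pow_neg)
    ultimately show ?case using inv PE by (metis empty_iff insert_iff)
  next
    case (eng x y)
    have dc: "d k \<otimes> c [^] j = c [^] j \<otimes> d k" for j k :: int
    proof -
      have "d k \<otimes> c [^] j = a \<otimes> (b [^] k \<otimes> c [^] j)" using cl by (simp add: d_def m_assoc)
      also have "\<dots> = (a \<otimes> c [^] j) \<otimes> b [^] k" unfolding bc_pow using cl by (simp add: m_assoc)
      also have "\<dots> = c [^] j \<otimes> d k" unfolding ac_pow using cl by (simp add: d_def m_assoc)
      finally show ?thesis .
    qed
    have dd: "d k \<otimes> d j = c \<otimes> b [^] (j - k)" for j k :: int
    proof -
      have "d k \<otimes> d j = (d k \<otimes> a) \<otimes> b [^] j" using cl by (simp add: d_def m_assoc)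
      also have "d k \<otimes> a = a \<otimes> (b [^] k \<otimes> a)" using cl by (simp add: d_def m_assoc)
      also have "\<dots> \<otimes> b [^] j = c \<otimes> (b [^] (-k) \<otimes> b [^] j)"
        unfolding b_pow_a using cl by (simp add: c_def m_assoc)
      also have "\<dots> = c \<otimes> b [^] (j - k)" using cl by (simp flip: int_pow_mult)
      finally show ?thesis .
    qed
    \<comment> \<open>Collecting the powers of \<open>c\<close> on the left leaves only products of
      the remaining factors.\<close>
    have 1: "(c [^] k \<otimes> s) \<otimes> (c [^] l \<otimes> t) = c [^] (k + l) \<otimes> (s \<otimes> t)"
      if "s \<otimes> c [^] l = c [^] l \<otimes> s" "s \<in> carrier G" "t \<in> carrier G" for k l :: int and s t
    proof -
      have "(c [^] k \<otimes> s) \<otimes> (c [^] l \<otimes> t) = c [^] k \<otimes> (s \<otimes> c [^] l) \<otimes> t"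
        using that(2,3) cl by (simp add: m_assoc)
      also have "\<dots> = c [^] (k + l) \<otimes> (s \<otimes> t)"
        unfolding that(1) using that(2,3) cl by (simp add: m_assoc int_pow_mult)
      finally show ?thesis .
    qed
    have 2: "c [^] k \<otimes> (c \<otimes> t) = c [^] (k + 1) \<otimes> t" if "t \<in> carrier G" for k :: int and t
      using that cl by (simp add: m_assoc int_pow_mult)
    show ?case
      using eng.IH unfolding P_def[of x] P_def[of y]
    proof (elim disjE exE)
      fix k j l i assume xy: "x = c [^] (k::int) \<otimes> b [^] (j::int)" "y = c [^] (l::int) \<otimes> b [^] (i::int)"
      have "x \<otimes> y = c [^] (k + l) \<otimes> b [^] (j + i)"
        unfolding xy using cl by (simp add: 1 bc_pow int_pow_mult)
      then show ?thesis using PE(1) by simp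
    next
      fix k j l i assume xy: "x = c [^] (k::int) \<otimes> b [^] (j::int)" "y = c [^] (l::int) \<otimes> d i"
      have "x \<otimes> y = c [^] (k + l) \<otimes> d (i - j)"
        unfolding xy using cl by (simp add: 1 bc_pow b_pow_d)
      then show ?thesis using PE(2) by simp
    next
      fix k j l i assume xy: "x = c [^] (k::int) \<otimes> d j" "y = c [^] (l::int) \<otimes> b [^] (i::int)"
      have "x \<otimes> y = c [^] (k + l) \<otimes> d (j + i)"
        unfolding xy using cl by (simp add: 1 dc d_b_pow)
      then show ?thesis using PE(2) by simp
    next
      fix k j l i assume xy: "x = c [^] (k::int) \<otimes> d j" "y = c [^] (l::int) \<otimes> d i"
      have "x \<otimes> y = c [^] (k + l + 1) \<otimes> b [^] (i - j)"
        unfolding xy using cl by (simp add: 1 dc dd 2)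
      then show ?thesis using PE(1) by simp
    qed
  qed
  then show ?thesis using assms generators unfolding P_def by blast
qed

lemma finite_carrier: "finite (carrier G)"
proof -
  have "carrier G \<subseteq> (\<lambda>(x, y). x \<otimes> y) ` (cyc c \<times> cyc b) \<union> (\<lambda>(x, y). x \<otimes> (a \<otimes> y)) ` (cyc c \<times> cyc b)"
    using elements unfolding d_def by fast
  moreover have "finite (cyc c)" using finite_cyc_torsion[OF c _ c_pow_n] n by simp
  moreover have "finite (cyc b)" using finite_cyc_torsion[OF b _ b_pow_3] by simp
  ultimately show ?thesis by (auto intro: finite_subset)
qed

text \<open>The inversion of \<open>b\<close> by \<open>a\<close> makes any power of \<open>b\<close> commuting with \<open>a\<close> an involution.\<close>

lemma b_pow_mem_cyc_c:
  assumes "b [^] (j::int) \<in> cyc c"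
  shows "b [^] j = \<one>"
proof -
  let ?z = "b [^] j"
  have z: "?z \<in> carrier G" using b by simp
  have "a \<otimes> ?z = ?z \<otimes> a" using assms ac_pow by auto
  also have "\<dots> = a \<otimes> inv ?z" using b by (simp add: b_pow_a int_pow_neg)
  finally have "?z = inv ?z" using a z by simp
  then have "b [^] (2 * j) = \<one>"
    using z b int_pow_mult[of b j j] r_inv[OF z] by (metis mult_2)
  moreover have "b [^] (3 * j) = \<one>" using b b_pow_3 by (simp flip: int_pow_pow)
  moreover have "?z = b [^] (3 * j - 2 * j)" by simp
  ultimately show ?thesis using b by (simp only: int_pow_diff) simp
qed

text \<open>As a centralizer, \<open>A\<close> is closed under powers at once; its description by
  products of powers of \<open>c\<close> and \<open>b\<close> needs
  \<open>b \<noteq> \<one>\<close>.\<close>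

definition A :: "'a set" where "A = {x \<in> carrier G. b \<otimes> x = x \<otimes> b}"

lemma A_closed: "x \<in> A \<Longrightarrow> x \<in> carrier G"
  by (simp add: A_def)

lemma c_in_A: "c \<in> A"
  using c bc by (simp add: A_def)

lemma cyc_subset_A: "g \<in> A \<Longrightarrow> cyc g \<subseteq> A"
  using int_pow_commute[of b g 1] b by (auto simp: A_def)

text \<open>By Bezout, \<open>j\<close> is a combination of \<open>j * q\<close> and
  \<open>3\<close>, and both exponents kill \<open>b\<close>.\<close>

lemma b_pow_eq_one_coprime:
  fixes j q :: int
  assumes "coprime q 3" "b [^] (j * q) = \<one>"
  shows "b [^] j = \<one>"
proof -
  obtain s t where "q * s + 3 * t = 1"
    using bezout_int[of q 3] assms(1) by (auto simp: mult.commute)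
  then have "j = (j * q) * s + 3 * (j * t)"
    by (metis (no_types, lifting) distrib_left mult.assoc mult.left_commute mult.right_neutral)
  then have "b [^] j = (b [^] (j * q)) [^] s \<otimes> (b [^] (3::int)) [^] (j * t)"
    using b by (metis int_pow_mult int_pow_pow)
  then show ?thesis using assms(2) b_pow_3 by simp
qed

end

text \<open>
  Splitting off the case \<open>b = 1\<close>, where the group is cyclic, avoids having to show that the
  presentation does not collapse.
\<close>

locale U6n_presentation_nontrivial = U6n_presentation +
  assumes b_nontrivial: "b \<noteq> \<one>"
begin

section \<open>Elements outside the centralizer of \<open>b\<close>\<close>

lemma c_pow_d_notin_A: "c [^] (k::int) \<otimes> d j \<notin> A"
proof
  assume *: "c [^] k \<otimes> d j \<in> A"
  have "b \<otimes> (c [^] k \<otimes> d j) = (b \<otimes> c [^] k) \<otimes> d j"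
    using b c d by (simp add: m_assoc)
  also have "b \<otimes> c [^] k = c [^] k \<otimes> b" using bc_pow[of 1 k] b by simp
  also have "\<dots> \<otimes> d j = c [^] k \<otimes> d (j - 1)"
    using b c d b_pow_d[of 1 j] by (simp add: m_assoc)
  also have "b \<otimes> (c [^] k \<otimes> d j) = c [^] k \<otimes> d j \<otimes> b"
    using * by (simp add: A_def)
  also have "\<dots> = c [^] k \<otimes> d (j + 1)"
    using b c d d_b_pow[of j 1] by (simp add: m_assoc)
  \<comment> \<open>Commuting with \<open>b\<close> would identify \<open>d (j + 1)\<close> with
    \<open>d (j - 1)\<close>; then \<open>b\<close> has trivial square and cube, so it is
    trivial.\<close>
  finally have "b [^] (j + 1) = b [^] (j - 1)" using a b c d by (simp add: d_def)
  then have "b [^] ((j + 1) - (j - 1)) = \<one>"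
    using b by (simp only: int_pow_diff) simp
  then have "b [^] (2::int) = \<one>" by simp
  then have "b [^] (3 - 2 :: int) = \<one>"
    unfolding int_pow_diff[OF b] b_pow_3 by simp
  then show False using b b_nontrivial by simp
qed

lemma A_elements:
  assumes "x \<in> A"
  obtains k j where "x = c [^] (k::int) \<otimes> b [^] (j::int)"
  using elements[OF A_closed[OF assms]] assms c_pow_d_notin_A by blast

lemma notin_A_mem_cyc_d:
  assumes "x \<in> carrier G" "x \<notin> A"
  obtains j where "x \<in> cyc (d j)"
proof -
  have "c [^] k \<otimes> b [^] j \<in> A" for k j :: int
  proof -
    have "b \<otimes> (c [^] k \<otimes> b [^] j) = (b \<otimes> c [^] k) \<otimes> b [^] j" using b c by (simp add: m_assoc)
    also have "b \<otimes> c [^] k = c [^] k \<otimes> b" using bc_pow[of 1 k] b by simp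
    also have "\<dots> \<otimes> b [^] j = c [^] k \<otimes> (b \<otimes> b [^] j)" using b c by (simp add: m_assoc)
    also have "b \<otimes> b [^] j = b [^] j \<otimes> b" using int_pow_commute[of b b 1 j] b by simp
    finally show ?thesis using b c by (simp add: A_def m_assoc)
  qed
  then show ?thesis using elements[OF assms(1)] assms(2) that c_pow_d by blast
qed

lemma cyc_d_cases:
  assumes "x \<in> cyc (d j)"
  shows "x \<in> cyc c \<or> (\<exists>k::int. x = c [^] k \<otimes> d j)"
proof -
  obtain m :: int where m: "x = d j [^] m" using assms by blast
  show ?thesis
  proof (cases "even m")
    case True
    then show ?thesis using m c_pow_eq_d_pow by (auto elim!: evenE)
  next
    case False
    then show ?thesis using m c_pow_d by (auto elim!: oddE)
  qed
qed

lemma cyc_d_inter_A: "x \<in> cyc (d j) \<Longrightarrow> x \<in> A \<Longrightarrow> x \<in> cyc c"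
  using cyc_d_cases c_pow_d_notin_A by metis

text \<open>Distinct groups \<open>cyc (d i)\<close> meet only inside \<open>A\<close>: equating two
  odd powers makes \<open>b [^] (j - i)\<close> a power of \<open>c\<close>, hence trivial.\<close>

lemma d_unique:
  assumes "x \<notin> A" "x \<in> cyc (d i)" "x \<in> cyc (d j)"
  shows "d i = d j"
proof -
  have "x \<notin> cyc c" using assms(1) cyc_subset_A[OF c_in_A] by blast
  then obtain k l :: int where x: "x = c [^] k \<otimes> d i" "x = c [^] l \<otimes> d j"
    using cyc_d_cases assms(2,3) by metis
  \<comment> \<open>With \<open>a\<close> in front, it can be cancelled from both expressions for
    \<open>x\<close>.\<close>
  have ca: "c [^] m \<otimes> d i = a \<otimes> (c [^] m \<otimes> b [^] i)" for m i :: int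
  proof -
    have "c [^] m \<otimes> d i = (c [^] m \<otimes> a) \<otimes> b [^] i" using a b c by (simp add: d_def m_assoc)
    then show ?thesis unfolding ac_pow[symmetric] using a b c by (simp add: m_assoc)
  qed
  have eq: "c [^] k \<otimes> b [^] i = c [^] l \<otimes> b [^] j"
    using x a b c by (simp add: ca)
  have "c [^] (k - l) \<otimes> b [^] i = c [^] (- l) \<otimes> (c [^] k \<otimes> b [^] i)"
    using b c by (simp add: m_assoc[symmetric] flip: int_pow_mult)
  also have "\<dots> = b [^] j"
    unfolding eq using b c by (simp add: m_assoc[symmetric] flip: int_pow_mult)
  finally have ji: "b [^] j = c [^] (k - l) \<otimes> b [^] i" by simp
  have "b [^] (j - i) = c [^] (k - l)"
    using b c unfolding int_pow_diff[OF b] ji by (simp add: m_assoc)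
  then have "b [^] (j - i) = \<one>" by (intro b_pow_mem_cyc_c) simp
  then have "b [^] j = b [^] i"
    using b by (metis diff_add_cancel int_pow_closed int_pow_mult l_one)
  then show ?thesis by (simp add: d_def)
qed

text \<open>A common generator \<open>g\<close> is outside \<open>A\<close> as well, so it lies in
  some \<open>cyc (d i)\<close>, and \<open>x\<close> determines which one.\<close>

lemma cocyclic_notin_A:
  assumes "x \<in> carrier G" "x \<notin> A" "x \<in> cyc (d j)" "cocyclic x y"
  shows "y \<in> cyc (d j)"
proof -
  obtain g where g: "g \<in> carrier G" "x \<in> cyc g" "y \<in> cyc g"
    using assms(4) unfolding cocyclic_def by blast
  then have "g \<notin> A" using assms(2) cyc_subset_A by blast
  then obtain i where "g \<in> cyc (d i)" using g(1) notin_A_mem_cyc_d by blast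
  then have sub: "cyc g \<subseteq> cyc (d i)" using cyc_mono d by blast
  then have "d i = d j" using d_unique assms(2,3) g(2) by blast
  then show ?thesis using sub g(3) by auto
qed

text \<open>A generator outside \<open>A\<close> can be replaced by \<open>c\<close>, because
  \<open>cyc (d j)\<close> meets \<open>A\<close> inside \<open>cyc c\<close>.\<close>

lemma cocyclic_in_A:
  assumes "x \<in> A" "y \<in> A" "cocyclic x y"
  obtains g where "g \<in> A" "x \<in> cyc g" "y \<in> cyc g"
proof -
  obtain g where g: "g \<in> carrier G" "x \<in> cyc g" "y \<in> cyc g"
    using assms(3) unfolding cocyclic_def by blast
  show ?thesis
  proof (cases "g \<in> A")
    case False
    then obtain j where "g \<in> cyc (d j)" using g(1) notin_A_mem_cyc_d by blast
    then have "x \<in> cyc (d j)" "y \<in> cyc (d j)" using cyc_mono[OF d] g by blast+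
    then show ?thesis using that[OF c_in_A] cyc_d_inter_A assms by blast
  qed (use g that in blast)
qed

text \<open>Here \<open>q\<close> stands for the part of \<open>n\<close> prime to 3. The condition
  \<open>f \<ge> 1\<close> makes \<open>3 ^ f\<close> kill \<open>b\<close> even when 3 does not
  divide \<open>n\<close>.\<close>

context
  fixes q :: int and f :: nat
  assumes q: "coprime q 3" and f: "f \<ge> 1" and n_dvd: "int n dvd q * 3 ^ f"
begin

section \<open>Elements of \<open>A\<close> through their \<open>q\<close>-th powers\<close>

lemma A_pow:
  "(c [^] (k::int) \<otimes> b [^] (j::int)) [^] (m::int) = c [^] (k * m) \<otimes> b [^] (j * m)"
  using b c int_pow_mult_distrib[OF bc_pow[symmetric]] by (simp add: int_pow_pow)

lemma A_torsion:
  assumes "x \<in> A"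
  shows "(x [^] q) [^] (3 ^ f :: int) = \<one>"
proof -
  obtain k j where x: "x = c [^] (k::int) \<otimes> b [^] (j::int)" using assms by (rule A_elements)
  have "(3::int) dvd 3 ^ f" using f by simp
  then have "(3::int) dvd j * (q * 3 ^ f)" by simp
  then have "b [^] (j * (q * 3 ^ f)) = \<one>" by (rule int_pow_eq_one_dvd[OF b b_pow_3])
  moreover have "int n dvd k * (q * 3 ^ f)" using n_dvd by simp
  then have "c [^] (k * (q * 3 ^ f)) = \<one>" by (rule int_pow_eq_one_dvd[OF c c_pow_n])
  ultimately show ?thesis
    using A_closed[OF assms] by (simp add: int_pow_pow) (simp add: x A_pow)
qed

text \<open>Both \<open>q\<close>-th powers are powers of \<open>g [^] q\<close>, whose order is a
  power of 3.\<close>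

lemma cocyclic_A_chain:
  assumes "x \<in> A" "y \<in> A" "cocyclic x y"
  shows "x [^] q \<in> cyc (y [^] q) \<or> y [^] q \<in> cyc (x [^] q)"
proof -
  obtain g where g: "g \<in> A" "x \<in> cyc g" "y \<in> cyc g" using assms by (rule cocyclic_in_A)
  then obtain k l :: int where xy: "x = g [^] k" "y = g [^] l" by blast
  have "x [^] q = (g [^] q) [^] k" "y [^] q = (g [^] q) [^] l"
    using A_closed[OF g(1)] by (simp_all add: xy int_pow_pow mult.commute)
  then show ?thesis
    using prime_power_order_chain[of 3 "g [^] q" f k l] A_torsion[OF g(1)] A_closed[OF g(1)] by auto
qed

text \<open>The parts of order prime to 3 impose no condition, as they all lie in the cyclic group
  of \<open>c [^] 3 ^ f\<close>. Multiplying its generator by \<open>w [^] q\<close>, of coprime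
  order, yields a common generator for \<open>x\<close> and \<open>y\<close>.\<close>

lemma cocyclic_if_q_parts:
  assumes "x \<in> A" "y \<in> A" "w \<in> A" "x [^] q \<in> cyc (w [^] q)" "y [^] q \<in> cyc (w [^] q)"
  shows "cocyclic x y"
proof -
  let ?N = "3 ^ f :: int"
  let ?z = "c [^] ?N"
  have "?z [^] q = \<one>"
    using int_pow_eq_one_dvd[OF c c_pow_n n_dvd] c by (simp add: int_pow_pow mult.commute)
  moreover have "w [^] q \<otimes> ?z = ?z \<otimes> w [^] q"
  proof -
    obtain k j where w: "w = c [^] (k::int) \<otimes> b [^] (j::int)" using assms(3) by (rule A_elements)
    then have "w \<otimes> c = c [^] k \<otimes> (c \<otimes> b [^] j)"
      using b c bc_pow[of j 1] by (simp add: m_assoc)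
    also have "\<dots> = (c \<otimes> c [^] k) \<otimes> b [^] j"
      using b c int_pow_commute[of c c k 1] by (simp add: m_assoc[symmetric])
    also have "\<dots> = c \<otimes> w" using b c w by (simp add: m_assoc)
    finally show ?thesis by (rule int_pow_commute) (use A_closed[OF assms(3)] c in simp_all)
  qed
  \<comment> \<open>Raising to the power \<open>3 ^ f\<close> removes the factor from
    \<open>cyc b\<close>.\<close>
  moreover have "x [^] ?N \<in> cyc ?z" if xA: "x \<in> A" for x
  proof -
    obtain k j where x: "x = c [^] (k::int) \<otimes> b [^] (j::int)" using xA by (rule A_elements)
    have "(3::int) dvd j * ?N" using f by simp
    then have "x [^] ?N = c [^] (k * ?N)"
      using int_pow_eq_one_dvd[OF b b_pow_3] c by (simp add: x A_pow)
    also have "\<dots> = ?z [^] k" using c by (simp add: int_pow_pow mult.commute)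
    finally show ?thesis by blast
  qed
  moreover have "coprime q ?N" using q by simp
  ultimately have "u \<in> cyc (w [^] q \<otimes> ?z)" if "u \<in> A" "u [^] q \<in> cyc (w [^] q)" for u
    using mem_cyc_coprime_product[of "w [^] q" ?N ?z q u] that A_torsion[OF assms(3)]
      A_closed c assms(3) by simp
  then show ?thesis
    using assms A_closed c unfolding cocyclic_def
    by (intro bexI[of _ "w [^] q \<otimes> ?z"]) simp_all
qed

lemma mem_cyc_c_if_q_part:
  assumes "x \<in> A" "x [^] q \<in> cyc c"
  shows "x \<in> cyc c"
proof -
  obtain k j where x: "x = c [^] (k::int) \<otimes> b [^] (j::int)" using assms(1) by (rule A_elements)
  have "b [^] (j * q) = c [^] (- (k * q)) \<otimes> x [^] q"
    using b c by (simp add: x A_pow m_assoc[symmetric] flip: int_pow_mult)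
  then have "b [^] (j * q) \<in> cyc c" using cyc_mult[OF c] assms(2) by auto
  then have "b [^] j = \<one>" using q b_pow_mem_cyc_c b_pow_eq_one_coprime by blast
  then show ?thesis using c by (simp add: x)
qed

text \<open>For \<open>x\<close> in \<open>A\<close>, the larger of the cyclic groups of
  \<open>x [^] q\<close> and \<open>u [^] q\<close> contains the \<open>q\<close>-th powers of
  \<open>x\<close> and \<open>v\<close>. For \<open>x\<close> outside \<open>A\<close>,
  \<open>u\<close> lies in \<open>cyc c\<close>, hence so does \<open>v\<close>, and
  \<open>cyc c\<close> is inside the group \<open>cyc (d j)\<close> containing
  \<open>x\<close>.\<close>

lemma cocyclic_mono_q_part:
  assumes "u \<in> A" "v \<in> A" "v [^] q \<in> cyc (u [^] q)" "x \<in> carrier G" "cocyclic x u"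
  shows "cocyclic x v"
proof (cases "x \<in> A")
  case True
  have uq: "u [^] q \<in> carrier G" "x [^] q \<in> carrier G" using assms True A_closed by simp_all
  from cocyclic_A_chain[OF True assms(1,5)] show ?thesis
  proof
    assume "x [^] q \<in> cyc (u [^] q)"
    then show ?thesis using cocyclic_if_q_parts True assms(1-3) by blast
  next
    assume "u [^] q \<in> cyc (x [^] q)"
    then have "v [^] q \<in> cyc (x [^] q)" using cyc_mono[OF uq(2)] assms(3) by blast
    then show ?thesis using cocyclic_if_q_parts True assms(2) cyc_self[OF uq(2)] by blast
  qed
next
  case False
  then obtain j where j: "x \<in> cyc (d j)" using assms(4) notin_A_mem_cyc_d by blast
  then have "u \<in> cyc (d j)" using cocyclic_notin_A assms(4,5) False by blast
  then have "u \<in> cyc c" using cyc_d_inter_A assms(1) by blast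
  then have "cyc (u [^] q) \<subseteq> cyc c" using cyc_mono[OF c] cyc_pow[OF c] by blast
  then have "v \<in> cyc c" using mem_cyc_c_if_q_part assms(2,3) by blast
  then have "v \<in> cyc (d j)" using cyc_c_subset_d by blast
  then show ?thesis using j d unfolding cocyclic_def by blast
qed

end

section \<open>Nested closed neighbourhoods\<close>

lemma nested_cocyclic:
  assumes "u \<in> carrier G" "v \<in> carrier G" "cocyclic u v"
  shows "Collect (cocyclic u) \<subseteq> Collect (cocyclic v) \<or> Collect (cocyclic v) \<subseteq> Collect (cocyclic u)"
proof -
  \<comment> \<open>All neighbours of \<open>u\<close>, including \<open>v\<close>, lie in one
    \<open>cyc (d j)\<close>, so they are neighbours of \<open>v\<close>.\<close>
  have out: "Collect (cocyclic u) \<subseteq> Collect (cocyclic v)"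
    if "u \<in> carrier G" "u \<notin> A" "cocyclic u v" for u v
  proof -
    obtain j where j: "u \<in> cyc (d j)" using \<open>u \<in> carrier G\<close> \<open>u \<notin> A\<close> by (rule notin_A_mem_cyc_d)
    note nb = cocyclic_notin_A[OF that(1,2) j]
    show ?thesis using nb nb[OF that(3)] d unfolding cocyclic_def[of v] by blast
  qed
  show ?thesis
  proof (cases "u \<in> A \<and> v \<in> A")
    case False
    then show ?thesis using out[of u v] out[of v u] assms cocyclic_sym by blast
  next
    case True
    obtain q where q: "int n = 3 ^ multiplicity 3 (int n) * q" "\<not> 3 dvd q"
      using multiplicity_decompose'[of "int n" 3] n by auto
    \<comment> \<open>The successor secures a positive exponent when 3 does not divide
      \<open>n\<close>.\<close>
    let ?f = "Suc (multiplicity 3 (int n))"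
    have cop: "coprime q 3"
      using q(2) prime_imp_coprime[of "3::int" q] by (simp add: coprime_commute)
    have dvd: "int n dvd q * 3 ^ ?f"
      by (subst q(1)) (simp add: mult.commute)
    have sub: "Collect (cocyclic x) \<subseteq> Collect (cocyclic y)"
      if "x \<in> A" "y \<in> A" "y [^] q \<in> cyc (x [^] q)" for x y
    proof
      fix z assume "z \<in> Collect (cocyclic x)"
      then have "cocyclic z x" by (simp add: cocyclic_sym)
      moreover from this have "z \<in> carrier G" using cyc_closed unfolding cocyclic_def by blast
      ultimately have "cocyclic z y" using cocyclic_mono_q_part[OF cop _ dvd that] by simp
      then show "z \<in> Collect (cocyclic y)" by (simp add: cocyclic_sym)
    qed
    have "u [^] q \<in> cyc (v [^] q) \<or> v [^] q \<in> cyc (u [^] q)"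
      by (rule cocyclic_A_chain[OF cop _ dvd]) (use True assms(3) in simp_all)
    then show ?thesis using sub True by metis
  qed
qed

end

lemma (in U6n_presentation) perfect_enhanced_power_graph:
  "perfect_graph (with_proj (enhanced_power_graph G))"
proof (rule perfect_if_nested_neighbourhoods; (unfold enhanced_power_graph_dominates_iff)?)
  show "finite (verts (with_proj (enhanced_power_graph G)))"
    using finite_carrier by (simp add: enhanced_power_graph_def)
  fix u v assume uv: "u \<noteq> v \<and> cocyclic u v"
  show "u \<noteq> v" "v \<noteq> u \<and> cocyclic v u" using uv cocyclic_sym by auto
  have cl: "u \<in> carrier G" "v \<in> carrier G"
    using uv cyc_closed unfolding cocyclic_def by blast+
  have nb: "insert x {y. x \<noteq> y \<and> cocyclic x y} = Collect (cocyclic x)" if "x \<in> carrier G" for x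
    using cocyclic_refl[OF that] by auto
  have "Collect (cocyclic u) \<subseteq> Collect (cocyclic v) \<or> Collect (cocyclic v) \<subseteq> Collect (cocyclic u)"
  \<comment> \<open>If \<open>b\<close> is trivial, every \<open>d j\<close> is \<open>a\<close>,
    the group is \<open>cyc a\<close> and the graph is complete.\<close>
  proof (cases "b = \<one>")
    case True
    have bj: "b [^] j = \<one>" for j :: int using True by simp
    have "c \<in> cyc a"
      unfolding c_def by (rule cyc_mult[OF a cyc_self[OF a] cyc_self[OF a]])
    then have ck: "c [^] k \<in> cyc a" for k :: int
      by (rule cyc_pow[OF a])
    have "x \<in> cyc a" if xG: "x \<in> carrier G" for x
    proof -
      consider k :: int where "x = c [^] k" | k :: int where "x = c [^] k \<otimes> a"
        using elements[OF xG] a c unfolding d_def bj by auto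
      then show ?thesis
        using ck cyc_mult[OF a ck cyc_self[OF a]] by cases simp_all
    qed
    then have all: "cocyclic x y" if "x \<in> carrier G" "y \<in> carrier G" for x y
      unfolding cocyclic_def using that a by (intro bexI[of _ a] conjI)
    have "Collect (cocyclic u) \<subseteq> carrier G"
      using cyc_closed unfolding cocyclic_def by blast
    then show ?thesis using all[OF cl(2)] by blast
  next
    case False
    then interpret U6n_presentation_nontrivial G a b n by unfold_locales
    show ?thesis using nested_cocyclic cl uv by blast
  qed
  then show "insert u {w. u \<noteq> w \<and> cocyclic u w} \<subseteq> insert v {w. v \<noteq> w \<and> cocyclic v w} \<or>
      insert v {w. v \<noteq> w \<and> cocyclic v w} \<subseteq> insert u {w. u \<noteq> w \<and> cocyclic u w}"
    using nb cl by simp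
qed

section \<open>Presented groups\<close>

context
  fixes R :: "('g word \<times> 'g word) set"
begin

interpretation P: group "presented_group R"
  by (rule group_presented_group)

abbreviation word_class :: "'g word \<Rightarrow> 'g word set" where
  "word_class w \<equiv> pres_rel R `` {w}"

lemma presented_group_carrier: "carrier (presented_group R) = range word_class"
  by (auto simp: presented_group_def quotient_def)

lemma presented_group_one: "\<one>\<^bsub>presented_group R\<^esub> = word_class []"
  by (simp add: presented_group_def)

lemma word_class_eqI: "(u, v) \<in> R \<Longrightarrow> word_class u = word_class v"
  by (simp add: pres_class_eq_iff pres_eq.relation)

lemma word_class_replicate:
  "word_class (replicate k l) = word_class [l] [^]\<^bsub>presented_group R\<^esub> k"
proof (induction k)
  case (Suc k)
  have "word_class (replicate (Suc k) l) = word_class (replicate k l @ [l])"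
    by (simp add: replicate_append_same)
  then show ?case using Suc by (simp add: presented_group_mult[symmetric])
qed (simp add: presented_group_one)

lemma word_class_inverse:
  "word_class [(x, False)] = inv\<^bsub>presented_group R\<^esub> word_class [(x, True)]"
proof (rule P.inv_equality[symmetric])
  show "word_class [(x, False)] \<otimes>\<^bsub>presented_group R\<^esub> word_class [(x, True)] =
      \<one>\<^bsub>presented_group R\<^esub>"
    using pres_eq.cancel[of R x False]
    by (simp add: presented_group_mult presented_group_one pres_class_eq_iff)
qed (simp_all add: presented_group_carrier)

text \<open>Induction on words: a letter is a generator or the inverse of one.\<close>

lemma presented_group_generate:
  "carrier (presented_group R) =
    generate (presented_group R) (range (\<lambda>x. word_class [(x, True)]))"
    (is "_ = generate ?G ?S")
proof
  show "generate ?G ?S \<subseteq> carrier ?G"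
    by (intro P.generate_incl) (auto simp: presented_group_carrier)
  have "word_class w \<in> generate ?G ?S" for w
  proof (induction w)
    case Nil
    then show ?case using generate.one by (simp flip: presented_group_one)
  next
    case (Cons l w)
    obtain x s where l: "l = (x, s)" by (cases l)
    have "word_class [l] \<in> generate ?G ?S"
      by (cases s) (auto simp: l word_class_inverse intro: generate.incl generate.inv)
    with Cons.IH have "word_class [l] \<otimes>\<^bsub>?G\<^esub> word_class w \<in> generate ?G ?S"
      by (intro generate.eng)
    then show ?case by (simp add: presented_group_mult)
  qed
  then show "carrier ?G \<subseteq> generate ?G ?S" by (auto simp: presented_group_carrier)
qed

end

lemma U6n_presentation_U6n:
  assumes "n \<ge> 1"
  shows "U6n_presentation (U6n n)
    (pres_rel (U6n_relations n) `` {[(gen_a, True)]})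
    (pres_rel (U6n_relations n) `` {[(gen_b, True)]}) n"
proof -
  let ?R = "U6n_relations n"
  let ?k = "\<lambda>w. pres_rel ?R `` {w}"
  interpret group "U6n n" by (rule group_U6n)
  have gens: "range (\<lambda>x. ?k [(x, True)]) = {?k [(gen_a, True)], ?k [(gen_b, True)]}"
  proof (rule antisym)
    have "?k [(x, True)] \<in> {?k [(gen_a, True)], ?k [(gen_b, True)]}" for x
      by (cases x) simp_all
    then show "range (\<lambda>x. ?k [(x, True)]) \<subseteq> {?k [(gen_a, True)], ?k [(gen_b, True)]}"
      by (rule image_subsetI)
  qed simp
  note eqI = word_class_eqI[of _ _ ?R]
  show ?thesis
  \<comment> \<open>Powers, inverses and products are rewritten as classes of single words, so that
    each equation becomes a defining relation.\<close>
  proof (unfold_locales; (unfold U6n_def)?)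
    show "?k [(gen_a, True)] \<in> carrier (presented_group ?R)"
      "?k [(gen_b, True)] \<in> carrier (presented_group ?R)"
      by (simp_all add: presented_group_carrier)
    show "carrier (presented_group ?R) =
        generate (presented_group ?R) {?k [(gen_a, True)], ?k [(gen_b, True)]}"
      using presented_group_generate[of ?R] by (simp only: gens)
    show "?k [(gen_a, True)] [^]\<^bsub>presented_group ?R\<^esub> (2 * n) = \<one>\<^bsub>presented_group ?R\<^esub>"
      unfolding word_class_replicate[symmetric] presented_group_one
      by (rule eqI) (simp add: U6n_relations_def)
    show "?k [(gen_b, True)] [^]\<^bsub>presented_group ?R\<^esub> (3::nat) = \<one>\<^bsub>presented_group ?R\<^esub>"
      unfolding word_class_replicate[symmetric] presented_group_one
      by (rule eqI) (simp add: U6n_relations_def)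
    show "?k [(gen_b, True)] \<otimes>\<^bsub>presented_group ?R\<^esub> ?k [(gen_a, True)] =
        ?k [(gen_a, True)] \<otimes>\<^bsub>presented_group ?R\<^esub> inv\<^bsub>presented_group ?R\<^esub> ?k [(gen_b, True)]"
      unfolding word_class_inverse[symmetric] presented_group_mult
      by (rule eqI) (simp add: U6n_relations_def)
  qed (rule assms)
qed

theorem theorem3p29:
  fixes n :: nat
  assumes "n \<ge> 1"
  shows "perfect_graph (with_proj (enhanced_power_graph (U6n n)))"
  using U6n_presentation.perfect_enhanced_power_graph[OF U6n_presentation_U6n[OF assms]] .

end
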